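(* Fix an optimal programming language (an optimal Gödel numbering of partial computable functions $\mathbb{N}\to\mathbb{N}$), and define the complexity $C(f)$ of a total computable function $f:\mathbb{N}\to\mathbb{N}$ as the minimal length of a program in this language that computes $f$. For each $n$, let \[ m_{w}(n)=\min\{C(f) : f \text{ total computable and } f \text{ weakly exceeds every total computable } g \text{ with } C(g)\le n\}, \] \[ m_{e}(n)=\min\{C(f) : f \text{ total computable and } f \text{ exceeds every total computable } g \text{ with } C(g)\le n\}. \] Then: (1) $m_w(n)=n+O(1)$, i.e. there is a constant $c$ such that $|m_w(n)-n|\le c$ for all $n$; (2) $m_e(n)=2^{n+O(1)}$, i.e. there is a constant $c$ such that $2^{n-c}\le m_e(n)\le 2^{n+c}$ for all $n$.
   Context: A function $f$ exceeds $g$ if $f(k)>g(k)$ for all $k\in\mathbb{N}$; $f$ weakly exceeds $g$ if $f(k)>g(k)$ for all sufficiently large $k$. An optimal programming language is one for which the resulting complexity is minimal up to an additive constant among all programming languages (Gödel numberings); the statements are understood up to such additive constants. *)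

theory Defs
  imports Complex_Main "HOL-Library.Extended_Nat"
begin

datatype recf =
    Zero
  | Succ
  | Proj nat
  | Comp recf "recf list"
  | PrimRec recf recf
  | Mu recf

text \<open>
  Kleene's partial recursive functions. Terms carry no arity: \<open>Zero\<close> and \<open>Proj i\<close> serve for
  every number of arguments, and where the number of arguments does not fit the result is undefined.
  Composition is strict, and the minimisation
  operator is undefined if the search meets an undefined value before the first zero.
\<close>

primrec eval :: "recf \<Rightarrow> nat list \<Rightarrow> nat option" where
  "eval Zero xs = Some 0"
| "eval Succ xs = (case xs of [x] \<Rightarrow> Some (Suc x) | _ \<Rightarrow> None)"
| "eval (Proj i) xs = (if i < length xs then Some (xs ! i) else None)"
| "eval (Comp f gs) xs = Option.bind (those (map (\<lambda>g. eval g xs) gs)) (eval f)"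
| "eval (PrimRec f g) xs =
     (case xs of
        [] \<Rightarrow> None
      | x # ys \<Rightarrow> rec_nat (eval f ys) (\<lambda>k r. Option.bind r (\<lambda>v. eval g (k # v # ys))) x)"
| "eval (Mu f) xs =
     (if \<exists>n. eval f (n # xs) = Some 0 \<and> (\<forall>m<n. eval f (m # xs) \<noteq> None)
      then Some (LEAST n. eval f (n # xs) = Some 0)
      else None)"

definition computable :: "(nat \<Rightarrow> nat) \<Rightarrow> bool" where
  "computable f \<longleftrightarrow> (\<exists>r. \<forall>x. eval r [x] = Some (f x))"

text \<open>Bijective base-2 notation, least significant digit first; a bijection onto the naturals.\<close>

primrec string_code :: "bool list \<Rightarrow> nat" where
  "string_code [] = 0"
| "string_code (b # p) = 2 * string_code p + (if b then 2 else 1)"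

definition computable_string_map :: "(bool list \<Rightarrow> bool list) \<Rightarrow> bool" where
  "computable_string_map s \<longleftrightarrow>
     (\<exists>r. \<forall>p. eval r [string_code p] = Some (string_code (s p)))"

text \<open>\<open>U p\<close> is the partial function computed by the program \<open>p\<close> in the language \<open>U\<close>.\<close>

type_synonym language = "bool list \<Rightarrow> nat \<Rightarrow> nat option"

definition computable_language :: "language \<Rightarrow> bool" where
  "computable_language U \<longleftrightarrow> (\<exists>r. \<forall>p x. eval r [string_code p, x] = U p x)"

text \<open>
  Taking \<open>V\<close> constant in its first argument shows that every partial computable function
  has a program in a Goedel numbering.
\<close>

definition godel_numbering :: "language \<Rightarrow> bool" where
  "godel_numbering U \<longleftrightarrow>
     computable_language U \<and>
     (\<forall>V. computable_language V \<longrightarrow>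
        (\<exists>s. computable_string_map s \<and> (\<forall>p. U (s p) = V p)))"

definition computes :: "language \<Rightarrow> bool list \<Rightarrow> (nat \<Rightarrow> nat) \<Rightarrow> bool" where
  "computes U p f \<longleftrightarrow> (\<forall>x. U p x = Some (f x))"

text \<open>The value is \<open>\<infinity>\<close> if \<open>f\<close> has no program.\<close>

definition complexity :: "language \<Rightarrow> (nat \<Rightarrow> nat) \<Rightarrow> enat" where
  "complexity U f = (INF p \<in> {p. computes U p f}. enat (length p))"

definition optimal_language :: "language \<Rightarrow> bool" where
  "optimal_language U \<longleftrightarrow>
     godel_numbering U \<and>
     (\<forall>V. godel_numbering V \<longrightarrow>
        (\<exists>c::nat. \<forall>f. computable f \<longrightarrow> complexity U f \<le> complexity V f + enat c))"

definition exceeds :: "(nat \<Rightarrow> nat) \<Rightarrow> (nat \<Rightarrow> nat) \<Rightarrow> bool" where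
  "exceeds f g \<longleftrightarrow> (\<forall>k. f k > g k)"

definition weakly_exceeds :: "(nat \<Rightarrow> nat) \<Rightarrow> (nat \<Rightarrow> nat) \<Rightarrow> bool" where
  "weakly_exceeds f g \<longleftrightarrow> (\<forall>\<^sub>F k in sequentially. f k > g k)"

text \<open>Infima in \<^typ>\<open>enat\<close> of non-empty sets are minima; the infimum of the empty set is \<open>\<infinity>\<close>.\<close>

definition m_w :: "language \<Rightarrow> nat \<Rightarrow> enat" where
  "m_w U n = Inf {complexity U f | f. computable f \<and>
     (\<forall>g. computable g \<and> complexity U g \<le> enat n \<longrightarrow> weakly_exceeds f g)}"

definition m_e :: "language \<Rightarrow> nat \<Rightarrow> enat" where
  "m_e U n = Inf {complexity U f | f. computable f \<and>
     (\<forall>g. computable g \<and> complexity U g \<le> enat n \<longrightarrow> exceeds f g)}"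

end

theory Submission
  imports Defs
begin

text \<open>
  A function never weakly exceeds itself, so both minima are larger than \<open>n\<close>.

  Upper bounds: given the number of total programs of length at most \<open>n\<close>, which takes \<open>n + 1\<close> bits,
  one can search at argument \<open>x\<close> for that many programs halting on \<open>0, \<dots>, x\<close> and take a value above
  their outputs at \<open>x\<close>. For large \<open>x\<close> the programs found are exactly the total ones. Given instead the
  list of the total programs, about \<open>2 ^ (n + 1)\<close> bits, one exceeds them everywhere.

  Lower bound for \<open>m_e\<close>: let \<open>L = 2 ^ m\<close> and let \<open>N t\<close> count the programs shorter than \<open>L\<close> that halt on
  \<open>0\<close> within \<open>t\<close> steps. For each \<open>j < L\<close> the waiting time for the bit \<open>j\<close> of \<open>N\<close> to be set has complexity
  \<open>m + O(1)\<close>, and it is total if this bit is set in the limit. If \<open>f\<close> exceeds all these functions that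
  are total, then iterating \<open>t \<mapsto> t + f t\<close> makes the bits of \<open>N\<close> final one by one, from the highest on.
  Thus a program of \<open>f\<close>, from whose length \<open>m\<close> is computed, yields a number above all outputs of
  programs shorter than \<open>L\<close>, and the corresponding constant function has complexity at least \<open>L\<close>.
\<close>

section \<open>Total computable functions of an environment\<close>

text \<open>
  The arguments are the first \<open>k\<close> entries of an environment, so that passing under a binder is
  a shift of the environment and closure rules apply by plain higher-order unification.
\<close>

definition tc :: "nat \<Rightarrow> ((nat \<Rightarrow> nat) \<Rightarrow> nat) \<Rightarrow> bool" where
  "tc k F \<longleftrightarrow> (\<exists>r. \<forall>e. eval r (map e [0..<k]) = Some (F e))"

definition dc :: "nat \<Rightarrow> ((nat \<Rightarrow> nat) \<Rightarrow> bool) \<Rightarrow> bool" where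
  "dc k P \<longleftrightarrow> tc k (\<lambda>e. of_bool (P e))"

lemma those_map_Some [simp]: "those (map (\<lambda>i. Some (a i)) l) = Some (map a l)"
  by (induction l) auto

lemma map_case_nat_upt [simp]: "map (case_nat a e) [0..<Suc k] = a # map e [0..<k]"
  by (simp add: map_upt_Suc del: upt_Suc)

lemma tc_var: "i < k \<Longrightarrow> tc k (\<lambda>e. e i)"
  unfolding tc_def by (rule exI[of _ "Proj i"]) simp

text \<open>As \<open>tc m F\<close> quantifies over whole environments, \<open>F\<close> depends on
  the first \<open>m\<close> entries only; hence computability is asked of \<open>G i\<close> just
  for \<open>i < m\<close>.\<close>

lemma tc_compose:
  assumes "tc m F" and "\<And>i. i < m \<Longrightarrow> tc k (G i)"
  shows "tc k (\<lambda>e. F (\<lambda>i. G i e))"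
proof -
  obtain rF where rF: "\<And>e. eval rF (map e [0..<m]) = Some (F e)"
    using assms(1) unfolding tc_def by blast
  have "\<forall>i. \<exists>r. i < m \<longrightarrow> (\<forall>e. eval r (map e [0..<k]) = Some (G i e))"
    using assms(2) unfolding tc_def by blast
  then obtain rG where rG: "\<And>i e. i < m \<Longrightarrow> eval (rG i) (map e [0..<k]) = Some (G i e)"
    by metis
  have "eval (Comp rF (map rG [0..<m])) (map e [0..<k]) = Some (F (\<lambda>i. G i e))" for e
  proof -
    have "map (\<lambda>g. eval g (map e [0..<k])) (map rG [0..<m]) = map (\<lambda>i. Some (G i e)) [0..<m]"
      using rG by simp
    then show ?thesis
      using rF[of "\<lambda>i. G i e"] by (simp only: eval.simps those_map_Some Option.bind.simps)
  qed
  then show ?thesis unfolding tc_def by blast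
qed

lemma tc_Suc: "tc k A \<Longrightarrow> tc k (\<lambda>e. Suc (A e))"
proof -
  have "tc 1 (\<lambda>e. Suc (e 0))"
    unfolding tc_def by (rule exI[of _ Succ]) simp
  then show "tc k A \<Longrightarrow> tc k (\<lambda>e. Suc (A e))"
    by (rule tc_compose)
qed

lemma tc_const: "tc k (\<lambda>e. c)"
proof (induction c)
  case 0
  show ?case unfolding tc_def by (rule exI[of _ Zero]) simp
qed (rule tc_Suc)

text \<open>Counter and accumulator occupy entries 0 and 1 in the environment of the step function,
  in the order in which \<open>PrimRec\<close> passes them; the parameters follow, shifted by
  two.\<close>

lemma tc_rec:
  assumes "tc k A" and "tc (Suc (Suc k)) (\<lambda>e. H (e 0) (e (Suc 0)) (\<lambda>i. e (Suc (Suc i))))"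
    and "tc k N"
  shows "tc k (\<lambda>e. rec_nat (A e) (\<lambda>i r. H i r e) (N e))"
proof -
  obtain ra where ra: "\<And>e. eval ra (map e [0..<k]) = Some (A e)"
    using assms(1) unfolding tc_def by blast
  obtain rh where "\<And>e. eval rh (map e [0..<Suc (Suc k)]) =
      Some (H (e 0) (e (Suc 0)) (\<lambda>i. e (Suc (Suc i))))"
    using assms(2) unfolding tc_def by blast
  from this[of "case_nat _ (case_nat _ _)"]
  have rh: "eval rh (i # v # map e [0..<k]) = Some (H i v e)" for i v e
    by (simp del: upt_Suc)
  have "eval (PrimRec ra rh) (x # map e [0..<k]) = Some (rec_nat (A e) (\<lambda>i r. H i r e) x)" for x e
    by (induction x) (simp_all add: ra rh)
  then have "eval (PrimRec ra rh) (map e [0..<Suc k]) =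
      Some (rec_nat (A (\<lambda>i. e (Suc i))) (\<lambda>j r. H j r (\<lambda>i. e (Suc i))) (e 0))" for e
    by (simp add: map_upt_Suc del: upt_Suc eval.simps)
  then have "tc (Suc k) (\<lambda>e. rec_nat (A (\<lambda>i. e (Suc i))) (\<lambda>j r. H j r (\<lambda>i. e (Suc i))) (e 0))"
    unfolding tc_def by blast
  \<comment> \<open>The recursion was shown with its bound in entry 0; composing with
    \<open>case_nat (N e) e\<close> puts \<open>N e\<close> there.\<close>
  moreover have "tc k (\<lambda>e. case_nat (N e) e i)" if "i < Suc k" for i
    using that assms(3) by (cases i) (simp_all add: tc_var)
  ultimately show ?thesis
    using tc_compose[of "Suc k" _ k "\<lambda>i e. case_nat (N e) e i"] by fastforce
qed

section \<open>Arithmetic and bounded sums\<close>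

lemma tc_add: "tc k A \<Longrightarrow> tc k B \<Longrightarrow> tc k (\<lambda>e. A e + B e)"
proof -
  assume "tc k A" "tc k B"
  then have "tc k (\<lambda>e. rec_nat (A e) (\<lambda>i r. Suc r) (B e))"
    by (intro tc_rec tc_Suc tc_var) auto
  moreover have "rec_nat a (\<lambda>i r. Suc r) b = a + b" for a b :: nat
    by (induction b) auto
  ultimately show ?thesis by simp
qed

text \<open>In the recursion step \<open>A e\<close> would stand under two binders. So the function
  of two variables is treated first and then composed with \<open>A\<close> and \<open>B\<close>;
  likewise for powers and quotients.\<close>

lemma tc_mult: "tc k A \<Longrightarrow> tc k B \<Longrightarrow> tc k (\<lambda>e. A e * B e)"
proof -
  assume AB: "tc k A" "tc k B"
  have "tc 2 (\<lambda>e. rec_nat 0 (\<lambda>i r. r + e 0) (e 1))"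
    by (intro tc_rec tc_const tc_add tc_var) auto
  moreover have "rec_nat 0 (\<lambda>i r. r + a) b = a * b" for a b :: nat
    by (induction b) auto
  ultimately have "tc 2 (\<lambda>e. e 0 * e 1)" by simp
  from tc_compose[OF this, of k "\<lambda>i. if i = 0 then A else B"] AB
  show ?thesis by simp
qed

lemma tc_diff: "tc k A \<Longrightarrow> tc k B \<Longrightarrow> tc k (\<lambda>e. A e - B e)"
proof -
  assume AB: "tc k A" "tc k B"
  have pred: "tc m (\<lambda>e. F e - 1)" if "tc m F" for m F
  proof -
    \<comment> \<open>The step discards the accumulator and returns the counter of the last round,
      which is the predecessor.\<close>
    have "tc m (\<lambda>e. rec_nat 0 (\<lambda>i r. i) (F e))"
      using that by (intro tc_rec tc_const tc_var) auto
    moreover have "rec_nat 0 (\<lambda>i r. i) a = a - 1" for a :: nat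
      by (cases a) auto
    ultimately show ?thesis by simp
  qed
  have "tc k (\<lambda>e. rec_nat (A e) (\<lambda>i r. r - 1) (B e))"
    using AB by (intro tc_rec pred tc_var) auto
  moreover have "rec_nat a (\<lambda>i r. r - 1) b = a - b" for a b :: nat
    by (induction b) auto
  ultimately show ?thesis by simp
qed

lemma tc_power: "tc k A \<Longrightarrow> tc k B \<Longrightarrow> tc k (\<lambda>e. A e ^ B e)"
proof -
  assume AB: "tc k A" "tc k B"
  have "tc 2 (\<lambda>e. rec_nat 1 (\<lambda>i r. r * e 0) (e 1))"
    by (intro tc_rec tc_const tc_mult tc_var) auto
  moreover have "rec_nat 1 (\<lambda>i r. r * a) b = a ^ b" for a b :: nat
    by (induction b) auto
  ultimately have "tc 2 (\<lambda>e. e 0 ^ e 1)" by simp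
  from tc_compose[OF this, of k "\<lambda>i. if i = 0 then A else B"] AB
  show ?thesis by simp
qed

lemma tc_weaken: "tc k F \<Longrightarrow> tc (Suc k) (\<lambda>e. F (\<lambda>i. e (Suc i)))"
  by (erule tc_compose) (simp add: tc_var)

lemma tc_sum:
  assumes "tc k N" and "tc (Suc k) (\<lambda>e. F (e 0) (\<lambda>i. e (Suc i)))"
  shows "tc k (\<lambda>e. \<Sum>i<N e. F i e)"
proof -
  \<comment> \<open>The step of the recursion sees the accumulator in entry 1; the renaming skips
    it.\<close>
  have "tc (Suc (Suc k)) (\<lambda>e. F (e 0) (\<lambda>i. e (Suc (Suc i))))"
    using tc_compose[OF assms(2), of "Suc (Suc k)" "\<lambda>i e. e (if i = 0 then 0 else Suc i)"]
    by (simp add: tc_var)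
  then have "tc k (\<lambda>e. rec_nat 0 (\<lambda>i r. r + F i e) (N e))"
    using assms(1) by (intro tc_rec tc_const tc_add tc_var) auto
  moreover have "rec_nat 0 (\<lambda>i r. r + f i) n = (\<Sum>i<n. f i)" for n and f :: "nat \<Rightarrow> nat"
    by (induction n) auto
  ultimately show ?thesis by simp
qed

section \<open>Decidable predicates and bounded quantifiers\<close>

lemma tc_of_bool: "dc k P \<Longrightarrow> tc k (\<lambda>e. of_bool (P e))"
  by (simp add: dc_def)

lemma dc_le: "tc k A \<Longrightarrow> tc k B \<Longrightarrow> dc k (\<lambda>e. A e \<le> B e)"
proof -
  assume "tc k A" "tc k B"
  then have "tc k (\<lambda>e. 1 - (A e - B e))"
    by (intro tc_diff tc_const)
  moreover have "1 - (a - b) = of_bool (a \<le> b)" for a b :: nat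
    by auto
  ultimately show ?thesis by (simp add: dc_def)
qed

lemma dc_not: "dc k P \<Longrightarrow> dc k (\<lambda>e. \<not> P e)"
proof -
  assume "dc k P"
  then have "tc k (\<lambda>e. 1 - of_bool (P e))"
    by (intro tc_diff tc_const tc_of_bool)
  moreover have "1 - of_bool p = (of_bool (\<not> p) :: nat)" for p
    by auto
  ultimately show ?thesis by (simp add: dc_def)
qed

lemma dc_conj: "dc k P \<Longrightarrow> dc k Q \<Longrightarrow> dc k (\<lambda>e. P e \<and> Q e)"
  unfolding dc_def of_bool_conj by (rule tc_mult)

lemma dc_imp: "dc k P \<Longrightarrow> dc k Q \<Longrightarrow> dc k (\<lambda>e. P e \<longrightarrow> Q e)"
  using dc_not[OF dc_conj[OF _ dc_not], of k P Q] by simp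

lemma dc_eq: "tc k A \<Longrightarrow> tc k B \<Longrightarrow> dc k (\<lambda>e. A e = B e)"
  unfolding order_eq_iff by (intro dc_conj dc_le)

lemma dc_less: "tc k A \<Longrightarrow> tc k B \<Longrightarrow> dc k (\<lambda>e. A e < B e)"
  unfolding not_le[symmetric] by (intro dc_not dc_le)

text \<open>The number of counterexamples below the bound is a sum, and it is 0 iff there are
  none.\<close>

lemma dc_ball:
  assumes "tc k N" and "dc (Suc k) (\<lambda>e. P (e 0) (\<lambda>i. e (Suc i)))"
  shows "dc k (\<lambda>e. \<forall>i<N e. P i e)"
proof -
  have "dc k (\<lambda>e. (\<Sum>i<N e. of_bool (\<not> P i e)) = (0::nat))"
    using assms by (intro dc_eq tc_sum tc_const tc_of_bool dc_not)
  moreover have "((\<Sum>i<n. of_bool (\<not> p i)) = (0::nat)) = (\<forall>i<n. p i)" for n :: nat and p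
    by auto
  ultimately show ?thesis by simp
qed

lemma dc_bex:
  assumes "tc k N" and "dc (Suc k) (\<lambda>e. P (e 0) (\<lambda>i. e (Suc i)))"
  shows "dc k (\<lambda>e. \<exists>i<N e. P i e)"
  using dc_not[OF dc_ball[OF assms(1) dc_not], of P] assms(2) by simp

lemma tc_if: "dc k P \<Longrightarrow> tc k A \<Longrightarrow> tc k B \<Longrightarrow> tc k (\<lambda>e. if P e then A e else B e)"
proof -
  assume "dc k P" "tc k A" "tc k B"
  then have "tc k (\<lambda>e. of_bool (P e) * A e + of_bool (\<not> P e) * B e)"
    by (intro tc_add tc_mult tc_of_bool dc_not)
  moreover have "(of_bool p * a + of_bool (\<not> p) * b) = (if p then a else b)" for p and a b :: nat
    by auto
  ultimately show ?thesis by simp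
qed

text \<open>The quotient counts the positive multiples of the divisor that do not exceed the
  dividend. For divisor 0 every index would be counted, hence the separate case giving 0.\<close>

lemma tc_div: "tc k A \<Longrightarrow> tc k B \<Longrightarrow> tc k (\<lambda>e. A e div B e)"
proof -
  assume AB: "tc k A" "tc k B"
  have "tc 2 (\<lambda>e. if e 1 = 0 then 0 else \<Sum>i<e 0. of_bool (Suc i * e 1 \<le> e 0))"
    by (intro tc_if dc_eq tc_sum tc_of_bool dc_le tc_mult tc_Suc tc_var tc_const) auto
  moreover have "(if b = 0 then 0 else \<Sum>i<a. of_bool (Suc i * b \<le> a)) = a div b" for a b :: nat
  proof (cases "b = 0")
    case False
    then have "Suc i * b \<le> a \<longleftrightarrow> i < a div b" for i
      using less_eq_div_iff_mult_less_eq[of b "Suc i" a] by (simp add: Suc_le_eq)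
    then have "(\<Sum>i<a. of_bool (Suc i * b \<le> a)) = card ({..<a} \<inter> {..<a div b})"
      by (simp add: lessThan_def)
    also have "{..<a} \<inter> {..<a div b} = {..<a div b}"
      by (auto intro: less_le_trans[OF _ div_le_dividend])
    finally show ?thesis using False by simp
  qed simp
  ultimately have "tc 2 (\<lambda>e. e 0 div e 1)" by (simp only:)
  from tc_compose[OF this, of k "\<lambda>i. if i = 0 then A else B"] AB
  show ?thesis by simp
qed

lemma dc_odd: "tc k A \<Longrightarrow> dc k (\<lambda>e. odd (A e))"
proof -
  assume "tc k A"
  then have "dc k (\<lambda>e. A e - 2 * (A e div 2) = 1)"
    by (intro dc_eq tc_diff tc_mult tc_div tc_const)
  moreover have "a - 2 * (a div 2) = 1 \<longleftrightarrow> odd a" for a :: nat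
    by presburger
  ultimately show ?thesis by simp
qed

lemmas tc_intros = tc_var tc_const tc_Suc tc_add tc_mult tc_diff tc_power tc_sum tc_of_bool tc_if
  tc_div dc_le dc_not dc_conj dc_imp dc_eq dc_less dc_ball dc_bex dc_odd

text \<open>The length of the string with code \<open>x\<close>.\<close>

definition lg :: "nat \<Rightarrow> nat" where
  "lg x = (\<Sum>j<x. of_bool (2 ^ Suc j \<le> Suc x))"

lemma tc_lg: "tc k A \<Longrightarrow> tc k (\<lambda>e. lg (A e))"
proof -
  assume A: "tc k A"
  have "tc 1 (\<lambda>e. lg (e 0))"
    unfolding lg_def by (intro tc_intros) auto
  from tc_compose[OF this, of k "\<lambda>i. A"] A
  show ?thesis by simp
qed

text \<open>The indices counted by \<open>lg x\<close> are \<open>0, ..., l - 1\<close>, and the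
  cut-off at \<open>x\<close> loses none of them because
  \<open>l < 2 ^ l \<le> x + 1\<close>.\<close>

lemma lg_eqI:
  assumes "2 ^ l \<le> Suc x" "Suc x < 2 ^ Suc l"
  shows "lg x = l"
proof -
  have "2 ^ Suc j \<le> Suc x \<longleftrightarrow> j < l" for j
  proof
    assume "2 ^ Suc j \<le> Suc x"
    then have "(2::nat) ^ Suc j < 2 ^ Suc l" using assms(2) by linarith
    then show "j < l" by simp
  next
    assume "j < l"
    then have "(2::nat) ^ Suc j \<le> 2 ^ l" by (intro power_increasing) auto
    then show "2 ^ Suc j \<le> Suc x" using assms(1) by linarith
  qed
  then have "lg x = card ({..<x} \<inter> {..<l})"
    by (simp add: lg_def lessThan_def)
  also have "l \<le> x"
    using assms(1) less_exp[of l] by linarith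
  then have "{..<x} \<inter> {..<l} = {..<l}" by auto
  finally show ?thesis by simp
qed

lemma lg_bounds: "2 ^ lg x \<le> Suc x" "Suc x < 2 ^ Suc (lg x)"
proof -
  obtain l where "2 ^ l \<le> Suc x" "Suc x < 2 ^ Suc l"
    using ex_power_ivl1[of 2 "Suc x"] by auto
  moreover from this have "lg x = l" by (rule lg_eqI)
  ultimately show "2 ^ lg x \<le> Suc x" "Suc x < 2 ^ Suc (lg x)" by auto
qed

section \<open>Approximations with bounded search\<close>

text \<open>Only the unbounded searches are cut off; all else terminates anyway.\<close>

primrec eval_upto :: "nat \<Rightarrow> recf \<Rightarrow> nat list \<Rightarrow> nat option" where
  "eval_upto t Zero xs = Some 0"
| "eval_upto t Succ xs = (case xs of [x] \<Rightarrow> Some (Suc x) | _ \<Rightarrow> None)"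
| "eval_upto t (Proj i) xs = (if i < length xs then Some (xs ! i) else None)"
| "eval_upto t (Comp f gs) xs =
     Option.bind (those (map (\<lambda>g. eval_upto t g xs) gs)) (eval_upto t f)"
| "eval_upto t (PrimRec f g) xs =
     (case xs of
        [] \<Rightarrow> None
      | x # ys \<Rightarrow>
          rec_nat (eval_upto t f ys) (\<lambda>k r. Option.bind r (\<lambda>v. eval_upto t g (k # v # ys))) x)"
| "eval_upto t (Mu f) xs =
     (if \<exists>n<t. eval_upto t f (n # xs) = Some 0 \<and> (\<forall>m<n. eval_upto t f (m # xs) \<noteq> None)
      then Some (LEAST n. eval_upto t f (n # xs) = Some 0)
      else None)"

section \<open>Convergence of the approximations\<close>

lemma those_map_eq_Some_iff:
  "those (map f l) = Some ys \<longleftrightarrow> list_all2 (\<lambda>x y. f x = Some y) l ys"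
proof (induction l arbitrary: ys)
  case (Cons x l)
  then show ?case
    by (cases ys) (auto split: option.splits)
qed auto

text \<open>Serves exact and cut-off minimisation at once, with \<open>Q n\<close> being true or
  \<open>n < t\<close>. The witness \<open>n\<close> may lie above the least zero; \<open>Q\<close>
  is downward closed so that it passes from the one to the other.\<close>

lemma first_zero_eq_Some_iff:
  fixes F :: "nat \<Rightarrow> nat option"
  assumes "\<And>m n. m \<le> n \<Longrightarrow> Q n \<Longrightarrow> Q m"
  shows "(if \<exists>n. Q n \<and> F n = Some 0 \<and> (\<forall>m<n. F m \<noteq> None)
      then Some (LEAST n. F n = Some 0) else None) = Some v \<longleftrightarrow>
    Q v \<and> F v = Some 0 \<and> (\<forall>m<v. \<exists>w. F m = Some (Suc w))" (is "?L = _ \<longleftrightarrow> ?R")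
proof
  assume L: "?L = Some v"
  then obtain n where n: "Q n" "F n = Some 0" "\<forall>m<n. F m \<noteq> None"
    and v: "v = (LEAST n. F n = Some 0)"
    by (auto split: if_splits)
  have Fv: "F v = Some 0" and vn: "v \<le> n"
    unfolding v using n(2) by (auto intro: LeastI Least_le)
  have "\<exists>w. F m = Some (Suc w)" if "m < v" for m
  proof -
    have "F m \<noteq> Some 0" using that not_less_Least unfolding v by blast
    moreover have "F m \<noteq> None" using that vn n(3) by auto
    ultimately show ?thesis using not0_implies_Suc by auto
  qed
  then show ?R using Fv assms[OF vn n(1)] by blast
next
  assume R: ?R
  then have "(LEAST n. F n = Some 0) = v"
    by (intro Least_equality) (auto, metis not_le option.inject nat.distinct(1))
  moreover have "\<exists>n. Q n \<and> F n = Some 0 \<and> (\<forall>m<n. F m \<noteq> None)"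
    using R by (intro exI[of _ v]) auto
  ultimately show "?L = Some v" by simp
qed

lemma eval_Mu_eq_Some_iff:
  "eval (Mu f) xs = Some v \<longleftrightarrow>
     eval f (v # xs) = Some 0 \<and> (\<forall>m<v. \<exists>w. eval f (m # xs) = Some (Suc w))"
  using first_zero_eq_Some_iff[of "\<lambda>_. True" "\<lambda>n. eval f (n # xs)"] by simp

lemma eval_upto_Mu_eq_Some_iff:
  "eval_upto t (Mu f) xs = Some v \<longleftrightarrow>
     v < t \<and> eval_upto t f (v # xs) = Some 0 \<and> (\<forall>m<v. \<exists>w. eval_upto t f (m # xs) = Some (Suc w))"
  using first_zero_eq_Some_iff[of "\<lambda>n. n < t" "\<lambda>n. eval_upto t f (n # xs)"] by simp

text \<open>Handles primitive recursion both when the cut-off grows and when it is replaced by exact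
  evaluation.\<close>

lemma rec_bind_mono:
  assumes "rec_nat a (\<lambda>k r. Option.bind r (h k)) x = Some v"
    and "\<And>v. a = Some v \<Longrightarrow> a' = Some v"
    and "\<And>k u v. h k u = Some v \<Longrightarrow> h' k u = Some v"
  shows "rec_nat a' (\<lambda>k r. Option.bind r (h' k)) x = Some v"
  using assms(1)
proof (induction x arbitrary: v)
  case (Suc x)
  then show ?case using assms(3) by (fastforce simp: bind_eq_Some_conv)
qed (use assms(2) in simp)

lemma eval_upto_mono:
  "eval_upto t r xs = Some v \<Longrightarrow> t \<le> t' \<Longrightarrow> eval_upto t' r xs = Some v"
proof (induction r arbitrary: xs v)
  case (Comp f gs)
  then obtain ys where ys: "list_all2 (\<lambda>g y. eval_upto t g xs = Some y) gs ys"
    "eval_upto t f ys = Some v"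
    by (auto simp: bind_eq_Some_conv those_map_eq_Some_iff)
  from ys(1) have "list_all2 (\<lambda>g y. eval_upto t' g xs = Some y) gs ys"
    by (rule list.rel_mono_strong) (use Comp in auto)
  then show ?case
    using ys(2) Comp by (auto simp: bind_eq_Some_conv those_map_eq_Some_iff)
next
  case (PrimRec f g)
  then show ?case
    by (auto split: list.splits elim!: rec_bind_mono)
next
  case (Mu f)
  then show ?case
    unfolding eval_upto_Mu_eq_Some_iff by (meson less_le_trans)
qed auto

lemma eval_upto_sound: "eval_upto t r xs = Some v \<Longrightarrow> eval r xs = Some v"
proof (induction r arbitrary: xs v)
  case (Comp f gs)
  then obtain ys where ys: "list_all2 (\<lambda>g y. eval_upto t g xs = Some y) gs ys"
    "eval_upto t f ys = Some v"
    by (auto simp: bind_eq_Some_conv those_map_eq_Some_iff)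
  from ys(1) have "list_all2 (\<lambda>g y. eval g xs = Some y) gs ys"
    by (rule list.rel_mono_strong) (use Comp in auto)
  then show ?case
    using ys(2) Comp by (auto simp: bind_eq_Some_conv those_map_eq_Some_iff)
next
  case (PrimRec f g)
  then show ?case
    by (auto split: list.splits elim!: rec_bind_mono)
next
  case (Mu f)
  then show ?case
    unfolding eval_upto_Mu_eq_Some_iff eval_Mu_eq_Some_iff by meson
qed auto

text \<open>A convergent computation uses finitely many values. Each is found for all large
  cut-offs, hence all of them together are.\<close>

lemma eval_upto_complete:
  "eval r xs = Some v \<Longrightarrow> \<forall>\<^sub>F t in sequentially. eval_upto t r xs = Some v"
proof (induction r arbitrary: xs v)
  case (Comp f gs)
  then obtain ys where ys: "list_all2 (\<lambda>g y. eval g xs = Some y) gs ys" "eval f ys = Some v"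
    by (auto simp: bind_eq_Some_conv those_map_eq_Some_iff)
  from ys(1) have "list_all2 (\<lambda>g y. \<forall>\<^sub>F t in sequentially. eval_upto t g xs = Some y) gs ys"
    by (rule list.rel_mono_strong) (use Comp in auto)
  then have "\<forall>\<^sub>F t in sequentially. list_all2 (\<lambda>g y. eval_upto t g xs = Some y) gs ys"
    by (induction rule: list_all2_induct) (auto intro: eventually_conj)
  moreover have "\<forall>\<^sub>F t in sequentially. eval_upto t f ys = Some v"
    using Comp ys(2) by blast
  ultimately show ?case
    by eventually_elim (auto simp: bind_eq_Some_conv those_map_eq_Some_iff)
next
  case (PrimRec f g)
  then obtain x ys where xs: "xs = x # ys"
    by (auto split: list.splits)
  have "\<forall>\<^sub>F t in sequentially.
      rec_nat (eval_upto t f ys) (\<lambda>k r. Option.bind r (\<lambda>v. eval_upto t g (k # v # ys))) x = Some v"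
    if "rec_nat (eval f ys) (\<lambda>k r. Option.bind r (\<lambda>v. eval g (k # v # ys))) x = Some v" for x v
    using that
  proof (induction x arbitrary: v)
    case 0
    then show ?case using PrimRec.IH(1) by simp
  next
    case (Suc x)
    then obtain u where
      "rec_nat (eval f ys) (\<lambda>k r. Option.bind r (\<lambda>v. eval g (k # v # ys))) x = Some u"
      "eval g (x # u # ys) = Some v"
      by (auto simp: bind_eq_Some_conv)
    from Suc.IH[OF this(1)] PrimRec.IH(2)[OF this(2)] show ?case
      by eventually_elim simp
  qed
  then show ?case using PrimRec.prems by (simp add: xs)
next
  case (Mu f)
  then have 1: "eval f (v # xs) = Some 0" and "\<forall>m<v. \<exists>w. eval f (m # xs) = Some (Suc w)"
    unfolding eval_Mu_eq_Some_iff by auto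
  then obtain w where w: "\<And>m. m < v \<Longrightarrow> eval f (m # xs) = Some (Suc (w m))"
    by metis
  have "\<forall>\<^sub>F t in sequentially. \<forall>m\<in>{..<v}. eval_upto t f (m # xs) = Some (Suc (w m))"
    using w Mu.IH by (intro eventually_ball_finite) auto
  with Mu.IH[OF 1] eventually_gt_at_top[of v] show ?case
    unfolding eval_upto_Mu_eq_Some_iff by eventually_elim auto
qed auto

section \<open>Computability of the approximations\<close>

definition opt_code :: "nat option \<Rightarrow> nat" where
  "opt_code z = (case z of None \<Rightarrow> 0 | Some v \<Rightarrow> Suc v)"

lemma opt_code_simps [simp]: "opt_code None = 0" "opt_code (Some v) = Suc v"
  by (simp_all add: opt_code_def)

lemma opt_code_eq_iff [simp]:
  "opt_code z = 0 \<longleftrightarrow> z = None" "opt_code z = Suc v \<longleftrightarrow> z = Some v"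
  by (cases z; simp)+

lemma opt_code_bind:
  "opt_code (Option.bind z h) = (if opt_code z = 0 then 0 else opt_code (h (opt_code z - 1)))"
  by (cases z) auto

lemma those_map_conv_opt_code:
  "those (map f l) =
     (if \<forall>i<length l. opt_code (f (l ! i)) \<noteq> 0
      then Some (map (\<lambda>i. opt_code (f (l ! i)) - 1) [0..<length l]) else None)"
proof (induction l)
  case (Cons x l)
  have "(\<forall>i<Suc n. P i) \<longleftrightarrow> P 0 \<and> (\<forall>i<n. P (Suc i))" for n and P :: "nat \<Rightarrow> bool"
    by (auto simp: less_Suc_eq_0_disj)
  with Cons show ?case
    by (cases "f x") (auto simp: map_upt_Suc simp del: upt_Suc)
qed simp

text \<open>Here \<open>m\<close> is a fixed number, not computed from the environment, so the
  \<open>P i\<close> may be decided by unrelated programs.\<close>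

lemma dc_all_const: "(\<And>i. i < m \<Longrightarrow> dc k (P i)) \<Longrightarrow> dc k (\<lambda>e. \<forall>i<m. P i e)"
  for m :: nat
proof (induction m)
  case 0
  then show ?case by (simp add: dc_def tc_const)
next
  case (Suc m)
  then show ?case unfolding All_less_Suc by (intro dc_conj) auto
qed

text \<open>Bounded minimisation as a sum: the indices \<open>i\<close> such that \<open>P\<close>
  fails on all of \<open>0, ..., i\<close> are those below the least solution.\<close>

lemma sum_eq_Least:
  assumes "P n" "n < t"
  shows "(\<Sum>i<t. of_bool (\<forall>j<Suc i. \<not> P j)) = (LEAST n. P n)"
proof -
  let ?l = "LEAST n. P n"
  have l: "P ?l" "?l < t"
    using assms LeastI[of P n] Least_le[of P n] by auto
  have "(\<forall>j<Suc i. \<not> P j) \<longleftrightarrow> i < ?l" for i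
  proof
    assume "\<forall>j<Suc i. \<not> P j"
    with l(1) have "\<not> ?l < Suc i" by blast
    then show "i < ?l" by simp
  next
    assume "i < ?l"
    then show "\<forall>j<Suc i. \<not> P j" by (auto intro!: not_less_Least[of _ P])
  qed
  then have "(\<Sum>i<t. of_bool (\<forall>j<Suc i. \<not> P j)) = card ({..<t} \<inter> {..<?l})"
    by (simp add: lessThan_def)
  also have "{..<t} \<inter> {..<?l} = {..<?l}" using l(2) by auto
  finally show ?thesis by simp
qed

text \<open>Induction on the term \<open>r\<close>, which is fixed outside the environment. Cut-off
  and arguments are arbitrary computable functions \<open>T\<close> and \<open>X i\<close>, so that
  the hypotheses apply under the binders of recursion and minimisation.\<close>

lemma tc_eval_upto:
  "tc n T \<Longrightarrow> (\<And>i. i < k \<Longrightarrow> tc n (X i)) \<Longrightarrow>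
     tc n (\<lambda>e. opt_code (eval_upto (T e) r (map (\<lambda>i. X i e) [0..<k])))"
proof (induction r arbitrary: n k T X)
  case Zero
  show ?case by (simp add: tc_const)
next
  case Succ
  show ?case
  proof (cases "k = 1")
    case True
    then show ?thesis using Succ by (simp add: tc_Suc)
  next
    case False
    then have "eval_upto (T e) Succ (map (\<lambda>i. X i e) [0..<k]) = None" for e
      by (auto split: list.splits simp: map_eq_Cons_conv upt_eq_Cons_conv)
    then show ?thesis by (simp add: tc_const)
  qed
next
  case (Proj i)
  then show ?case by (cases "i < k") (simp_all add: tc_Suc tc_const)
next
  case (Comp f gs)
  define C where "C i e = opt_code (eval_upto (T e) (gs ! i) (map (\<lambda>i. X i e) [0..<k]))" for i e
  have bind_if: "opt_code (Option.bind (if q then Some y else None) h) =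
      (if q then opt_code (h y) else 0)" for q and y :: "nat list" and h
    by simp
  have C: "tc n (C i)" if "i < length gs" for i
    unfolding C_def using that Comp.prems by (intro Comp.IH(2)) auto
  have "tc n (\<lambda>e. if \<forall>i<length gs. C i e \<noteq> 0
      then opt_code (eval_upto (T e) f (map (\<lambda>i. C i e - 1) [0..<length gs])) else 0)"
    using C Comp.prems
    by (intro tc_if Comp.IH(1) dc_all_const dc_not dc_eq tc_diff tc_const) auto
  moreover have "opt_code (eval_upto (T e) (Comp f gs) (map (\<lambda>i. X i e) [0..<k])) =
      (if \<forall>i<length gs. C i e \<noteq> 0
       then opt_code (eval_upto (T e) f (map (\<lambda>i. C i e - 1) [0..<length gs])) else 0)" for e
    unfolding eval_upto.simps those_map_conv_opt_code C_def bind_if ..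
  ultimately show ?case by (simp only:)
next
  case (PrimRec f g)
  show ?case
  proof (cases k)
    case 0
    then show ?thesis by (simp add: tc_const)
  next
    case (Suc k')
    define A where "A e = opt_code (eval_upto (T e) f (map (\<lambda>i. X (Suc i) e) [0..<k']))" for e
    define C where "C i v e = opt_code (eval_upto (T e) g (map
        (\<lambda>j. case_nat i (case_nat v (\<lambda>i. X (Suc i) e)) j) [0..<Suc (Suc k')]))" for i v e
    have A: "tc n A"
      unfolding A_def using PrimRec.prems Suc by (intro PrimRec.IH(1)) auto
    have T2: "tc (Suc (Suc n)) (\<lambda>e. T (\<lambda>i. e (Suc (Suc i))))"
      using tc_weaken[OF tc_weaken[OF PrimRec.prems(1)]] by simp
    have X2: "tc (Suc (Suc n)) (\<lambda>e. X i (\<lambda>i. e (Suc (Suc i))))" if "i < k" for i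
      using tc_weaken[OF tc_weaken[OF PrimRec.prems(2)[OF that]]] by simp
    \<comment> \<open>The accumulator is the code of a partial result; the value handed to
      \<open>g\<close> is this code minus 1.\<close>
    have C: "tc (Suc (Suc n)) (\<lambda>e. C (e 0) (e (Suc 0) - 1) (\<lambda>i. e (Suc (Suc i))))"
      unfolding C_def
    proof (rule PrimRec.IH(2)[OF T2])
      fix j assume "j < Suc (Suc k')"
      then consider "j = 0" | "j = 1" | i where "j = Suc (Suc i)" "i < k'"
        by (metis One_nat_def Suc_less_eq not0_implies_Suc)
      then show "tc (Suc (Suc n)) (\<lambda>e. case_nat (e 0)
          (case_nat (e (Suc 0) - 1) (\<lambda>i. X (Suc i) (\<lambda>i. e (Suc (Suc i))))) j)"
        using X2 Suc by cases (auto intro!: tc_diff tc_var tc_const)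
    qed
    have "tc n (\<lambda>e. rec_nat (A e) (\<lambda>i r. if r = 0 then 0 else C i (r - 1) e) (X 0 e))"
      using A C PrimRec.prems Suc by (intro tc_rec tc_if dc_eq tc_var tc_const) auto
    moreover have "opt_code (rec_nat (eval_upto (T e) f (map (\<lambda>i. X (Suc i) e) [0..<k']))
        (\<lambda>k r. Option.bind r (\<lambda>v. eval_upto (T e) g (k # v # map (\<lambda>i. X (Suc i) e) [0..<k']))) x) =
        rec_nat (A e) (\<lambda>i r. if r = 0 then 0 else C i (r - 1) e) x" for e x
    proof (induction x)
      case (Suc x)
      have "C i v e = opt_code (eval_upto (T e) g (i # v # map (\<lambda>i. X (Suc i) e) [0..<k']))" for i v
        by (simp add: C_def map_upt_Suc del: upt_Suc)
      then show ?case
        by (simp only: nat.rec opt_code_bind Suc)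
    qed (simp add: A_def)
    ultimately show ?thesis
      by (simp add: Suc map_upt_Suc del: upt_Suc)
  qed
next
  case (Mu f)
  define C where "C j e = opt_code (eval_upto (T e) f (map (\<lambda>i. case_nat j (\<lambda>i. X i e) i) [0..<Suc k]))"
    for j e
  have C: "tc (Suc n) (\<lambda>e. C (e 0) (\<lambda>i. e (Suc i)))"
    unfolding C_def
  proof (rule Mu.IH)
    show "tc (Suc n) (\<lambda>e. T (\<lambda>i. e (Suc i)))"
      using Mu.prems(1) by (rule tc_weaken)
    fix j assume "j < Suc k"
    then show "tc (Suc n) (\<lambda>e. case_nat (e 0) (\<lambda>i. X i (\<lambda>i. e (Suc i))) j)"
      using tc_weaken[OF Mu.prems(2)] by (cases j) (auto intro: tc_var)
  qed
  have C2: "tc (Suc (Suc n)) (\<lambda>e. C (e 0) (\<lambda>i. e (Suc (Suc i))))"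
    using tc_compose[OF C, of "Suc (Suc n)" "\<lambda>i e. e (if i = 0 then 0 else Suc i)"]
    by (simp add: tc_var)
  \<comment> \<open>Code 1 stands for the value 0, code 0 for undefined.\<close>
  have "tc n (\<lambda>e. if \<exists>j<T e. C j e = 1 \<and> (\<forall>m<j. C m e \<noteq> 0)
      then Suc (\<Sum>i<T e. of_bool (\<forall>j<Suc i. \<not> C j e = 1)) else 0)"
    using C C2 Mu.prems(1)
    by (intro tc_if dc_bex dc_conj dc_ball dc_not dc_eq tc_sum tc_of_bool tc_const tc_Suc tc_var) auto
  moreover have "opt_code (eval_upto (T e) (Mu f) (map (\<lambda>i. X i e) [0..<k])) =
      (if \<exists>j<T e. C j e = 1 \<and> (\<forall>m<j. C m e \<noteq> 0)
      then Suc (\<Sum>i<T e. of_bool (\<forall>j<Suc i. \<not> C j e = 1)) else 0)" for e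
  proof -
    have "C j e = opt_code (eval_upto (T e) f (j # map (\<lambda>i. X i e) [0..<k]))" for j
      by (simp add: C_def map_upt_Suc del: upt_Suc)
    then show ?thesis
      using sum_eq_Least[of "\<lambda>j. C j e = 1" _ "T e"] by auto
  qed
  ultimately show ?case by (simp only:)
qed

text \<open>One unbounded search followed by a total output function. All languages constructed in
  the proof have this form.\<close>

definition search_language ::
  "(nat \<Rightarrow> nat \<Rightarrow> nat \<Rightarrow> bool) \<Rightarrow> (nat \<Rightarrow> nat \<Rightarrow> nat \<Rightarrow> nat) \<Rightarrow> language" where
  "search_language P G = (\<lambda>p x.
     if \<exists>t. P t (string_code p) x
     then Some (G (LEAST t. P t (string_code p) x) (string_code p) x) else None)"

lemma computable_search_language:
  assumes "dc 3 (\<lambda>e. P (e 0) (e 1) (e 2))" and "tc 3 (\<lambda>e. G (e 0) (e 1) (e 2))"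
  shows "computable_language (search_language P G)"
proof -
  have upt3: "[0..<3] = [0, 1, 2::nat]" by (simp add: eval_nat_numeral)
  define env where "env a b c = case_nat a (case_nat b (\<lambda>_. c))" for a b c :: nat
  have env: "env a b c 0 = a" "env a b c 1 = b" "env a b c 2 = c" for a b c
    by (simp_all add: env_def numeral_2_eq_2)
  \<comment> \<open>\<open>Mu\<close> looks for a zero, hence the negation.\<close>
  obtain rP where "\<And>e. eval rP (map e [0..<3]) = Some (of_bool (\<not> P (e 0) (e 1) (e 2)))"
    using dc_not[OF assms(1)] unfolding dc_def tc_def by blast
  from this[of "env t c x" for t c x] have rP: "eval rP [t, c, x] = Some (of_bool (\<not> P t c x))" for t c x
    by (simp only: upt3 list.map env)
  obtain rG where "\<And>e. eval rG (map e [0..<3]) = Some (G (e 0) (e 1) (e 2))"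
    using assms(2) unfolding tc_def by blast
  from this[of "env t c x" for t c x] have rG: "eval rG [t, c, x] = Some (G t c x)" for t c x
    by (simp only: upt3 list.map env)
  have "eval (Comp rG [Mu rP, Proj 0, Proj 1]) [string_code p, x] = search_language P G p x" for p x
    by (simp add: rP rG search_language_def)
  then show ?thesis unfolding computable_language_def by blast
qed

section \<open>Consequences of optimality\<close>

text \<open>\<open>a t i x\<close> is 0 as long as stage \<open>t\<close> yields no output of the
  program with code \<open>i\<close> at \<open>x\<close>, and \<open>v + 1\<close> once it yields
  the output \<open>v\<close>.\<close>

locale approximation =
  fixes U :: language and a :: "nat \<Rightarrow> nat \<Rightarrow> nat \<Rightarrow> nat"
  assumes tc_approx3: "tc 3 (\<lambda>e. a (e 0) (e 1) (e 2))"
    and approx_stable: "t \<le> t' \<Longrightarrow> a t i x \<noteq> 0 \<Longrightarrow> a t' i x = a t i x"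
    and language_iff: "U p x = Some v \<longleftrightarrow> (\<exists>t. a t (string_code p) x = Suc v)"
begin

lemma tc_approx:
  assumes "tc k A" "tc k B" "tc k C"
  shows "tc k (\<lambda>e. a (A e) (B e) (C e))"
  using tc_compose[OF tc_approx3, of k "\<lambda>i. if i = 0 then A else if i = 1 then B else C"] assms
  by simp

lemma approx_eqI:
  assumes "U p x = Some v" "a t (string_code p) x \<noteq> 0"
  shows "a t (string_code p) x = Suc v"
proof -
  obtain w where "a t (string_code p) x = Suc w"
    using assms(2) not0_implies_Suc by blast
  then show ?thesis
    using assms(1) language_iff[of p x w] by auto
qed

lemma eventually_approx:
  assumes "a t i x \<noteq> 0"
  shows "\<forall>\<^sub>F t in sequentially. a t i x \<noteq> 0"
  using eventually_ge_at_top[of t] by eventually_elim (use approx_stable assms in metis)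

text \<open>Presents \<open>U\<close> itself as a search, so that it can be merged with other
  languages into one search language.\<close>

lemma search_approx:
  "(if \<exists>t. a t (string_code p) x \<noteq> 0
    then Some (a (LEAST t. a t (string_code p) x \<noteq> 0) (string_code p) x - 1) else None) = U p x"
proof (cases "U p x")
  case None
  then have "a t (string_code p) x = 0" for t
    using language_iff not0_implies_Suc by (metis option.distinct(1))
  with None show ?thesis by simp
next
  case (Some v)
  then have ex: "\<exists>t. a t (string_code p) x \<noteq> 0"
    using language_iff[of p x v] by (metis nat.distinct(1))
  from approx_eqI[OF Some LeastI_ex[OF ex]] ex Some show ?thesis by simp
qed

end

lemma ex_approximation:
  assumes "computable_language U"
  obtains a where "approximation U a"
proof -
  obtain r where r: "\<And>p x. eval r [string_code p, x] = U p x"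
    using assms unfolding computable_language_def by blast
  have upt2: "[0..<2] = [0, 1::nat]" by (simp add: eval_nat_numeral)
  have "approximation U (\<lambda>t i x. opt_code (eval_upto t r [i, x]))"
  proof
    show "tc 3 (\<lambda>e. opt_code (eval_upto (e 0) r [e 1, e 2]))"
      using tc_eval_upto[of 3 "\<lambda>e. e 0" 2 "\<lambda>i e. e (Suc i)" r]
      by (simp add: upt2 tc_var numeral_2_eq_2[symmetric])
  next
    fix t t' i x :: nat
    assume t: "t \<le> t'" and "opt_code (eval_upto t r [i, x]) \<noteq> 0"
    then obtain v where v: "eval_upto t r [i, x] = Some v" by auto
    from v eval_upto_mono[OF v t]
    show "opt_code (eval_upto t' r [i, x]) = opt_code (eval_upto t r [i, x])" by simp
  next
    fix p x v
    show "U p x = Some v \<longleftrightarrow> (\<exists>t. opt_code (eval_upto t r [string_code p, x]) = Suc v)"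
      unfolding r[symmetric] opt_code_eq_iff
      using eval_upto_sound eval_upto_complete eventually_happens'[OF sequentially_bot] by meson
  qed
  then show ?thesis by (rule that)
qed

lemma complexity_le: "computes U p f \<Longrightarrow> complexity U f \<le> enat (length p)"
  unfolding complexity_def by (rule INF_lower) simp

lemma complexity_leE:
  assumes "complexity U f \<le> enat n"
  obtains p where "computes U p f" "length p \<le> n" "complexity U f = enat (length p)"
proof -
  have "(\<lambda>p. enat (length p)) ` {p. computes U p f} \<noteq> {}"
    using assms by (auto simp: complexity_def Inf_enat_def split: if_splits)
  then have "complexity U f \<in> (\<lambda>p. enat (length p)) ` {p. computes U p f}"
    unfolding complexity_def Inf_enat_def by (auto intro: LeastI)
  then show ?thesis using assms that by auto
qed

lemma computable_if_computes:
  assumes "computable_language V" "computes V p f"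
  shows "computable f"
proof -
  obtain r where r: "\<And>p x. eval r [string_code p, x] = V p x"
    using assms(1) unfolding computable_language_def by blast
  obtain rc where rc: "\<And>e. eval rc (map e [0..<1]) = Some (string_code p)"
    using tc_const[of 1] unfolding tc_def by blast
  have "eval (Comp r [rc, Proj 0]) [x] = Some (f x)" for x
    using rc[of "\<lambda>_. x"] r[of p x] assms(2) by (simp add: computes_def)
  then show ?thesis unfolding computable_def by blast
qed

text \<open>Optimality compares \<open>U\<close> with Goedel numberings only, while \<open>V\<close>
  is any computable language. So \<open>V\<close> is merged with \<open>U\<close> into a language
  \<open>W\<close> whose programs choose between the two by their first bit; \<open>W\<close> is a
  Goedel numbering because \<open>U\<close> is one.\<close>

lemma optimal_language_bound:
  assumes "optimal_language U" "computable_language V"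
  obtains c where "\<And>p f. computes V p f \<Longrightarrow> complexity U f \<le> enat (length p + c)"
proof -
  have gU: "godel_numbering U" using assms(1) by (simp add: optimal_language_def)
  then have "computable_language U" by (simp add: godel_numbering_def)
  then obtain aU where "approximation U aU" by (rule ex_approximation)
  then interpret aU: approximation U aU .
  obtain aV where "approximation V aV" using assms(2) by (rule ex_approximation)
  then interpret aV: approximation V aV .
  \<comment> \<open>Odd codes belong to strings starting with \<open>False\<close>; both branches
    recover the code of the tail. The empty string, with code 0, is treated as the empty program of
    \<open>U\<close>.\<close>
  define h where "h t c x = (if odd c then aV t (c div 2) x else aU t (c div 2 - 1) x)" for t c x
  define W where "W = search_language (\<lambda>t c x. h t c x \<noteq> 0) (\<lambda>t c x. h t c x - 1)"
  have "tc 3 (\<lambda>e. h (e 0) (e 1) (e 2))"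
    unfolding h_def by (intro tc_intros aU.tc_approx aV.tc_approx) auto
  then have cW: "computable_language W"
    unfolding W_def by (intro computable_search_language tc_intros)
  have WV: "W (False # p) = V p" for p
    by (rule ext) (simp add: W_def search_language_def h_def flip: aV.search_approx)
  have WU: "W (True # p) = U p" for p
    by (rule ext) (simp add: W_def search_language_def h_def flip: aU.search_approx)
  have "godel_numbering W"
    unfolding godel_numbering_def
  proof (intro conjI allI impI cW)
    fix V' assume "computable_language V'"
    then obtain s where s: "computable_string_map s" "\<And>p. U (s p) = V' p"
      using gU unfolding godel_numbering_def by blast
    obtain r where r: "\<And>p. eval r [string_code p] = Some (string_code (s p))"
      using s(1) unfolding computable_string_map_def by blast
    have "tc 1 (\<lambda>e. 2 * e 0 + 2)" by (intro tc_intros) auto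
    then obtain r2 where r2: "\<And>e. eval r2 (map e [0..<1]) = Some (2 * e 0 + 2)"
      unfolding tc_def by blast
    have "eval (Comp r2 [r]) [string_code p] = Some (string_code (True # s p))" for p
      using r2[of "\<lambda>_. string_code (s p)"] r by simp
    then have "computable_string_map (\<lambda>p. True # s p)"
      unfolding computable_string_map_def by blast
    then show "\<exists>s. computable_string_map s \<and> (\<forall>p. W (s p) = V' p)"
      using s(2) WU by metis
  qed
  then obtain c where c: "\<And>f. computable f \<Longrightarrow> complexity U f \<le> complexity W f + enat c"
    using assms(1) unfolding optimal_language_def by blast
  show ?thesis
  \<comment> \<open>The additional 1 pays for the leading bit.\<close>
  proof (rule that[of "Suc c"])
    fix p f assume "computes V p f"
    then have f: "computes W (False # p) f" by (simp add: computes_def WV)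
    have "complexity U f \<le> complexity W f + enat c"
      by (rule c[OF computable_if_computes[OF cW f]])
    also have "\<dots> \<le> enat (length (False # p)) + enat c"
      by (intro add_right_mono complexity_le f)
    finally show "complexity U f \<le> enat (length p + Suc c)" by simp
  qed
qed

lemma computes_search_language:
  assumes "\<And>x. \<exists>t. P t (string_code p) x"
  shows "computes (search_language P G) p (\<lambda>x. G (LEAST t. P t (string_code p) x) (string_code p) x)"
  using assms by (simp add: computes_def search_language_def)

section \<open>String codes\<close>

text \<open>A code of length \<open>l\<close> is \<open>2 ^ l - 1\<close> plus the value of the string as a binary number.\<close>

definition payload :: "nat \<Rightarrow> nat" where
  "payload c = Suc c - 2 ^ lg c"

lemma tc_payload: "tc k A \<Longrightarrow> tc k (\<lambda>e. payload (A e))"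
  unfolding payload_def by (intro tc_intros tc_lg)

lemma Suc_string_code: "Suc (string_code p) = 2 ^ length p + horner_sum of_bool 2 p"
  by (induction p) auto

lemma horner_sum_less: "horner_sum of_bool 2 p < (2 ^ length p :: nat)"
  by (induction p) auto

lemma lg_string_code [simp]: "lg (string_code p) = length p"
  by (rule lg_eqI) (use Suc_string_code[of p] horner_sum_less[of p] in auto)

lemma payload_string_code: "payload (string_code p) = horner_sum of_bool 2 p"
  by (simp add: payload_def Suc_string_code)

text \<open>Codes order strings by length first, and there are \<open>2 ^ Suc n - 1\<close> strings
  of length at most \<open>n\<close>.\<close>

lemma string_code_less: "length p \<le> n \<Longrightarrow> string_code p < 2 ^ Suc n - 1"
proof -
  assume "length p \<le> n"
  then have "(2::nat) ^ Suc (length p) \<le> 2 ^ Suc n" by (intro power_increasing) auto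
  then show ?thesis
    using Suc_string_code[of p] horner_sum_less[of p] by (simp only: power_Suc)
qed

text \<open>Lets a program of length \<open>l\<close> carry two numbers: \<open>l\<close> itself and
  any \<open>j\<close> below \<open>2 ^ l\<close>.\<close>

lemma ex_string_payload:
  assumes "j < 2 ^ l"
  obtains p where "length p = l" "payload (string_code p) = j"
proof
  show "payload (string_code (map (bit j) [0..<l])) = j"
    using assms by (simp add: payload_string_code horner_sum_bit_eq_take_bit take_bit_nat_eq_self)
qed simp

section \<open>Upper bounds\<close>

context approximation
begin

definition tot :: "nat \<Rightarrow> bool" where
  "tot i \<longleftrightarrow> (\<forall>x. \<exists>t. a t i x \<noteq> 0)"

lemma tot_if_computes: "computes U p g \<Longrightarrow> tot (string_code p)"
  unfolding computes_def tot_def using language_iff by (metis nat.distinct(1))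

text \<open>Approximations that are nonzero stay so, hence finitely many searches succeed at a
  common stage.\<close>

lemma tot_simultaneously:
  assumes "finite S" "finite X" "\<And>i. i \<in> S \<Longrightarrow> tot i"
  shows "\<exists>t. \<forall>i\<in>S. \<forall>x\<in>X. a t i x \<noteq> 0"
proof -
  have "\<forall>\<^sub>F t in sequentially. \<forall>i\<in>S. \<forall>x\<in>X. a t i x \<noteq> 0"
    using assms eventually_approx unfolding tot_def
    by (intro eventually_ball_finite ballI) blast+
  from eventually_happens'[OF sequentially_bot this] show ?thesis .
qed

lemma exceeds_bound:
  assumes "optimal_language U"
  obtains c where "\<And>n. \<exists>f. computable f \<and> complexity U f \<le> enat (2 ^ Suc n + c) \<and>
     (\<forall>g. computable g \<and> complexity U g \<le> enat n \<longrightarrow> exceeds f g)"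
proof -
  \<comment> \<open>Bit \<open>i\<close> of the payload marks the program with code \<open>i\<close>
    as total; the search waits for the marked programs to halt at \<open>x\<close>.\<close>
  define P where "P t c x = (\<forall>i<lg c. odd (payload c div 2 ^ i) \<longrightarrow> a t i x \<noteq> 0)" for t c x
  define G where "G t c x = Suc (\<Sum>i<lg c. if odd (payload c div 2 ^ i) then a t i x else 0)" for t c x
  have V: "computable_language (search_language P G)"
    unfolding P_def G_def
    by (intro computable_search_language tc_intros tc_approx tc_lg tc_payload) auto
  obtain c where c: "\<And>p f. computes (search_language P G) p f \<Longrightarrow> complexity U f \<le> enat (length p + c)"
    using optimal_language_bound[OF assms V] by blast
  show ?thesis
  proof (rule that[of c])
    fix n
    define w where "w = map tot [0..<2 ^ Suc n]"
    have lw: "length w = 2 ^ Suc n" by (simp add: w_def)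
    have bit: "odd (payload (string_code w) div 2 ^ i) \<longleftrightarrow> tot i" if "i < length w" for i
      using that by (simp add: payload_string_code bit_horner_sum_bit_iff w_def flip: bit_iff_odd)
    have ex: "\<exists>t. P t (string_code w) x" for x
    proof -
      have "\<exists>t. \<forall>i\<in>{i. i < length w \<and> tot i}. \<forall>y\<in>{x}. a t i y \<noteq> 0"
        by (rule tot_simultaneously) simp_all
      then obtain t where "\<forall>i\<in>{i. i < length w \<and> tot i}. \<forall>y\<in>{x}. a t i y \<noteq> 0" ..
      then have "P t (string_code w) x" using bit by (simp add: P_def)
      then show ?thesis ..
    qed
    define f where "f x = G (LEAST t. P t (string_code w) x) (string_code w) x" for x
    have f: "computes (search_language P G) w f"
      unfolding f_def using ex by (rule computes_search_language)
    have "exceeds f g" if "complexity U g \<le> enat n" for g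
      unfolding exceeds_def
    proof
      fix x
      obtain p where p: "computes U p g" "length p \<le> n"
        using \<open>complexity U g \<le> enat n\<close> by (rule complexity_leE)
      let ?i = "string_code p" and ?t = "LEAST t. P t (string_code w) x"
      have i: "?i < length w" using string_code_less[OF p(2)] lw by simp
      have b: "odd (payload (string_code w) div 2 ^ ?i)"
        using bit[OF i] tot_if_computes[OF p(1)] by simp
      have "a ?t ?i x \<noteq> 0"
        using LeastI_ex[OF ex[of x]] i b unfolding P_def by simp
      then have "a ?t ?i x = Suc (g x)"
        using p(1) by (intro approx_eqI) (simp_all add: computes_def)
      moreover have "(if odd (payload (string_code w) div 2 ^ ?i) then a ?t ?i x else 0) \<le>
          (\<Sum>i<length w. if odd (payload (string_code w) div 2 ^ i) then a ?t i x else 0)"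
        using i by (intro member_le_sum) auto
      ultimately show "g x < f x"
        using b by (simp add: f_def G_def)
    qed
    then show "\<exists>f. computable f \<and> complexity U f \<le> enat (2 ^ Suc n + c) \<and>
        (\<forall>g. computable g \<and> complexity U g \<le> enat n \<longrightarrow> exceeds f g)"
      using c[OF f] computable_if_computes[OF V f] lw by auto
  qed
qed

lemma weakly_exceeds_bound:
  assumes "optimal_language U"
  obtains c where "\<And>n. \<exists>f. computable f \<and> complexity U f \<le> enat (n + c) \<and>
     (\<forall>g. computable g \<and> complexity U g \<le> enat n \<longrightarrow> weakly_exceeds f g)"
proof -
  \<comment> \<open>The length \<open>lg c\<close>, meant to be \<open>n + 1\<close>, determines the
    range of codes of programs of length at most \<open>n\<close>; the payload is meant to be the
    number of total ones.\<close>
  define P where "P t c x \<longleftrightarrow>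
      payload c \<le> (\<Sum>i<2 ^ lg c - 1. of_bool (\<forall>y<Suc x. a t i y \<noteq> 0))" for t c x
  define G where "G t c x =
      Suc (\<Sum>i<2 ^ lg c - 1. if \<forall>y<Suc x. a t i y \<noteq> 0 then a t i x else 0)" for t c x
  have V: "computable_language (search_language P G)"
    unfolding P_def G_def
    by (intro computable_search_language tc_intros tc_approx tc_lg tc_payload) auto
  obtain c where c: "\<And>p f. computes (search_language P G) p f \<Longrightarrow> complexity U f \<le> enat (length p + c)"
    using optimal_language_bound[OF assms V] by blast
  show ?thesis
  proof (rule that[of "Suc c"])
    fix n
    define M where "M = (2::nat) ^ Suc n - 1"
    define Tot where "Tot = {i. i < M \<and> tot i}"
    define S where "S t x = {i. i < M \<and> (\<forall>y<Suc x. a t i y \<noteq> 0)}" for t x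
    have fin: "finite Tot" "finite (S t x)" for t x by (simp_all add: Tot_def S_def)
    have "card Tot \<le> card {..<M}" by (rule card_mono) (auto simp: Tot_def)
    then have "card Tot < 2 ^ Suc n" by (simp add: M_def less_eq_iff_succ_less)
    then obtain w where w: "length w = Suc n" "payload (string_code w) = card Tot"
      by (rule ex_string_payload)
    have P_iff: "P t (string_code w) x \<longleftrightarrow> card Tot \<le> card (S t x)" for t x
      by (simp add: P_def w S_def M_def lessThan_def Collect_conj_eq)
    \<comment> \<open>The total programs alone make the search succeed at every \<open>x\<close>.
      For small \<open>x\<close> other programs may fill the count, which is harmless for weak
      exceeding.\<close>
    have ex: "\<exists>t. P t (string_code w) x" for x
    proof -
      have "\<exists>t. \<forall>i\<in>Tot. \<forall>y\<in>{..x}. a t i y \<noteq> 0"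
        using fin(1) by (rule tot_simultaneously) (simp_all add: Tot_def)
      then obtain t where "\<forall>i\<in>Tot. \<forall>y\<in>{..x}. a t i y \<noteq> 0" ..
      then have "Tot \<subseteq> S t x" unfolding Tot_def S_def by (auto simp: less_Suc_eq_le)
      then show ?thesis unfolding P_iff using card_mono[OF fin(2)] by blast
    qed
    define f where "f x = G (LEAST t. P t (string_code w) x) (string_code w) x" for x
    have f: "computes (search_language P G) w f"
      unfolding f_def using ex by (rule computes_search_language)
    \<comment> \<open>Each of the finitely many non-total programs diverges at some
      \<open>y\<close>, and for \<open>x \<ge> y\<close> it is not counted at any stage.\<close>
    have "\<forall>\<^sub>F x in sequentially. \<forall>i\<in>{..<M} - Tot. \<exists>y<Suc x. \<forall>t. a t i y = 0"
    proof (intro eventually_ball_finite ballI)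
      fix i assume "i \<in> {..<M} - Tot"
      then obtain y where y: "\<And>t. a t i y = 0" by (auto simp: Tot_def tot_def)
      show "\<forall>\<^sub>F x in sequentially. \<exists>y<Suc x. \<forall>t. a t i y = 0"
        using eventually_ge_at_top[of y] by eventually_elim (rule exI[of _ y], simp add: y)
    qed simp
    then have large: "\<forall>\<^sub>F x in sequentially. \<forall>t. S t x \<subseteq> Tot"
    proof eventually_elim
      case (elim x)
      show ?case
      proof (intro allI subsetI, rule ccontr)
        fix t i assume i: "i \<in> S t x" "i \<notin> Tot"
        then have "i \<in> {..<M} - Tot" by (simp add: S_def)
        with elim obtain y where "y < Suc x" "a t i y = 0" by blast
        with i(1) show False unfolding S_def by blast
      qed
    qed
    have "weakly_exceeds f g" if "complexity U g \<le> enat n" for g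
      unfolding weakly_exceeds_def using large
    proof eventually_elim
      case (elim x)
      obtain p where p: "computes U p g" "length p \<le> n"
        using \<open>complexity U g \<le> enat n\<close> by (rule complexity_leE)
      let ?i = "string_code p" and ?t = "LEAST t. P t (string_code w) x"
      have i: "?i < M" using string_code_less[OF p(2)] by (simp add: M_def)
      \<comment> \<open>Only total programs are counted at this \<open>x\<close>, and at least as
        many as exist, hence all of them.\<close>
      have "S ?t x = Tot"
        using card_seteq[OF fin(1), of "S ?t x"] elim LeastI_ex[OF ex[of x]] unfolding P_iff by blast
      then have b: "\<forall>y<Suc x. a ?t ?i y \<noteq> 0"
        using i tot_if_computes[OF p(1)] by (auto simp: Tot_def S_def)
      then have "a ?t ?i x = Suc (g x)"
        using p(1) by (intro approx_eqI) (simp_all add: computes_def)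
      then have "Suc (g x) = (if \<forall>y<Suc x. a ?t ?i y \<noteq> 0 then a ?t ?i x else 0)"
        by (subst if_P[OF b]) simp
      also have "\<dots> \<le> (\<Sum>i<M. if \<forall>y<Suc x. a ?t i y \<noteq> 0 then a ?t i x else 0)"
        using i by (intro member_le_sum) auto
      also have "\<dots> < f x"
        by (simp only: f_def G_def w lg_string_code M_def lessI)
      finally show "g x < f x" by simp
    qed
    then show "\<exists>f. computable f \<and> complexity U f \<le> enat (n + Suc c) \<and>
        (\<forall>g. computable g \<and> complexity U g \<le> enat n \<longrightarrow> weakly_exceeds f g)"
      using c[OF f] computable_if_computes[OF V f] w by auto
  qed
qed

end

section \<open>The lower bound for exceeding functions\<close>

text \<open>
  An increasing counter whose final value has bit \<open>b\<close> set shows this bit again and again, with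
  waiting times dominated by \<open>\<tau>\<close>. As soon as all higher bits are final, bit \<open>b\<close> can only
  change from unset to set, so one more waiting period makes it final as well.
\<close>

lemma counter_stabilises:
  fixes N \<tau> :: "nat \<Rightarrow> nat"
  assumes "mono N" "M < 2 ^ L" and le: "\<And>t. N t \<le> M" and "mono \<tau>"
    and step: "\<And>b k. b < L \<Longrightarrow> odd (M div 2 ^ b) \<Longrightarrow> \<exists>s. \<tau> k \<le> s \<and> s \<le> \<tau> (Suc k) \<and> odd (N s div 2 ^ b)"
  shows "N (\<tau> L) = M"
proof -
  \<comment> \<open>After \<open>k\<close> rounds the highest \<open>k\<close> of the
    \<open>L\<close> bits are final.\<close>
  have "k \<le> L \<Longrightarrow> N (\<tau> k) div 2 ^ (L - k) = M div 2 ^ (L - k)" for k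
  proof (induction k)
    case 0
    then show ?case using assms(2) le[of "\<tau> 0"] by simp
  next
    case (Suc k)
    define b where "b = L - Suc k"
    have b: "b < L" "L - k = Suc b" "L - Suc k = b" using Suc.prems by (auto simp: b_def)
    have dd: "n div 2 ^ Suc b = (n div 2 ^ b) div 2" for n :: nat
      by (simp only: power_Suc2 div_mult2_eq)
    have high: "(N s div 2 ^ b) div 2 = (M div 2 ^ b) div 2" if "\<tau> k \<le> s" for s
    proof (rule antisym)
      show "(N s div 2 ^ b) div 2 \<le> (M div 2 ^ b) div 2"
        by (intro div_le_mono le)
      have "(M div 2 ^ b) div 2 = (N (\<tau> k) div 2 ^ b) div 2"
        using Suc b(2) dd by simp
      also have "\<dots> \<le> (N s div 2 ^ b) div 2"
        using that by (intro div_le_mono monoD[OF \<open>mono N\<close>])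
      finally show "(M div 2 ^ b) div 2 \<le> (N s div 2 ^ b) div 2" .
    qed
    have le': "N s div 2 ^ b \<le> M div 2 ^ b" for s by (intro div_le_mono le)
    have tk: "\<tau> k \<le> \<tau> (Suc k)" by (rule monoD[OF \<open>mono \<tau>\<close>]) simp
    show ?case
    proof (cases "odd (M div 2 ^ b)")
      case True
      then obtain s where s: "\<tau> k \<le> s" "s \<le> \<tau> (Suc k)" "odd (N s div 2 ^ b)"
        using step b(1) by blast
      have "N s div 2 ^ b = M div 2 ^ b"
        using high[OF s(1)] s(3) True by (metis odd_two_times_div_two_succ)
      moreover have "N s div 2 ^ b \<le> N (\<tau> (Suc k)) div 2 ^ b"
        using s(2) by (intro div_le_mono monoD[OF \<open>mono N\<close>])
      ultimately show ?thesis using le'[of "\<tau> (Suc k)"] by (simp add: b)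
    next
      case False
      \<comment> \<open>If bit \<open>b\<close> of \<open>M\<close> is unset, the higher bits,
        already final, determine the least possible value, and \<open>M\<close> attains it.\<close>
      then have "M div 2 ^ b = 2 * ((M div 2 ^ b) div 2)" by simp
      also have "\<dots> \<le> N (\<tau> (Suc k)) div 2 ^ b"
        using high[OF tk] by simp
      finally show ?thesis using le'[of "\<tau> (Suc k)"] by (simp add: b)
    qed
  qed
  from this[of L] show ?thesis by simp
qed

section \<open>The halting counter and the iteration of an exceeding function\<close>

context approximation
begin

text \<open>The programs shorter than \<open>2 ^ m\<close> are those with codes below
  \<open>2 ^ 2 ^ m - 1\<close>; the count is of those that have halted on 0 by stage
  \<open>t\<close>.\<close>

definition halted :: "nat \<Rightarrow> nat \<Rightarrow> nat" where
  "halted m t = (\<Sum>i<2 ^ 2 ^ m - 1. of_bool (a t i 0 \<noteq> 0))"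

lemma tc_halted: "tc k A \<Longrightarrow> tc k B \<Longrightarrow> tc k (\<lambda>e. halted (A e) (B e))"
proof -
  assume AB: "tc k A" "tc k B"
  have "tc 2 (\<lambda>e. halted (e 0) (e 1))"
    unfolding halted_def by (intro tc_intros tc_approx) auto
  from tc_compose[OF this, of k "\<lambda>i. if i = 0 then A else B"] AB
  show ?thesis by simp
qed

lemma halted_card: "halted m t = card {i. i < 2 ^ 2 ^ m - 1 \<and> a t i 0 \<noteq> 0}"
  by (simp add: halted_def lessThan_def Collect_conj_eq)

lemma halted_subset:
  "t \<le> t' \<Longrightarrow> {i. i < n \<and> a t i 0 \<noteq> 0} \<subseteq> {i. i < n \<and> a t' i 0 \<noteq> 0}"
  using approx_stable by fastforce

lemma mono_halted: "mono (halted m)"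
  unfolding halted_card by (intro monoI card_mono halted_subset) auto

text \<open>So the counter has \<open>2 ^ m\<close> binary digits, and \<open>m\<close> bits suffice
  to name a digit position.\<close>

lemma halted_less: "halted m t < 2 ^ 2 ^ m"
proof -
  have "halted m t \<le> card {..<2 ^ 2 ^ m - 1 :: nat}"
    unfolding halted_card by (intro card_mono) auto
  then show ?thesis by (simp add: less_eq_iff_succ_less)
qed

lemma halted_final:
  "\<exists>M t0. (\<forall>t\<ge>t0. halted m t = M) \<and> (\<forall>t. halted m t \<le> M)"
proof -
  have "range (halted m) \<subseteq> {..<2 ^ 2 ^ m}"
    using halted_less by blast
  then have fin: "finite (range (halted m))"
    by (rule finite_subset) simp
  have "Max (range (halted m)) \<in> range (halted m)"
    by (rule Max_in[OF fin]) simp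
  then obtain t0 where t0: "Max (range (halted m)) = halted m t0"
    by (rule rangeE)
  have le: "halted m t \<le> halted m t0" for t
    unfolding t0[symmetric] by (rule Max_ge[OF fin rangeI])
  show ?thesis
    by (rule exI[of _ "halted m t0"], rule exI[of _ t0]) (auto intro: antisym le monoD[OF mono_halted])
qed

text \<open>
  \<open>iter T c k\<close> is the successor of \<open>\<tau> k\<close>, where \<open>\<tau> 0 = 0\<close>, \<open>\<tau> (k + 1) = \<tau> k + f (\<tau> k)\<close> for the
  function \<open>f\<close> with program code \<open>c\<close>, and \<open>0\<close> if this is not found in \<open>T\<close> steps.
\<close>

definition iter :: "nat \<Rightarrow> nat \<Rightarrow> nat \<Rightarrow> nat" where
  "iter T c k = rec_nat 1 (\<lambda>_ s. if s = 0 then 0 else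
     if a T c (s - 1) = 0 then 0 else s + (a T c (s - 1) - 1)) k"

lemma tc_iter:
  assumes "tc k A" "tc k B" "tc k C"
  shows "tc k (\<lambda>e. iter (A e) (B e) (C e))"
proof -
  have "tc 3 (\<lambda>e. iter (e 0) (e 1) (e 2))"
    unfolding iter_def by (intro tc_rec tc_intros tc_approx) auto
  from tc_compose[OF this, of k "\<lambda>i. if i = 0 then A else if i = 1 then B else C"] assms
  show ?thesis by simp
qed

lemma iter_correct:
  assumes "computes U p f" "\<tau> 0 = 0" "\<And>k. \<tau> (Suc k) = \<tau> k + f (\<tau> k)"
    and "iter T (string_code p) k \<noteq> 0"
  shows "iter T (string_code p) k = Suc (\<tau> k)"
  using assms(4)
proof (induction k)
  case 0
  then show ?case using assms(2) by (simp add: iter_def)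
next
  case (Suc k)
  then have 1: "iter T (string_code p) k = Suc (\<tau> k)"
    by (auto simp: iter_def split: if_splits)
  with Suc.prems have "a T (string_code p) (\<tau> k) \<noteq> 0"
    by (auto simp: iter_def split: if_splits)
  then have "a T (string_code p) (\<tau> k) = Suc (f (\<tau> k))"
    using assms(1) by (intro approx_eqI) (simp_all add: computes_def)
  with 1 show ?case by (simp add: iter_def assms(3))
qed

lemma eventually_iter:
  assumes "computes U p f"
  shows "\<forall>\<^sub>F T in sequentially. iter T (string_code p) k \<noteq> 0"
proof (induction k)
  case 0
  show ?case by (simp add: iter_def)
next
  case (Suc k)
  define \<tau> where "\<tau> = rec_nat 0 (\<lambda>_ t. t + f t)"
  obtain t where "a t (string_code p) (\<tau> k) \<noteq> 0"
    using tot_if_computes[OF assms] unfolding tot_def by blast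
  then have "\<forall>\<^sub>F T in sequentially. a T (string_code p) (\<tau> k) \<noteq> 0"
    by (rule eventually_approx)
  with Suc show ?case
  proof eventually_elim
    case (elim T)
    have "iter T (string_code p) k = Suc (\<tau> k)"
      by (rule iter_correct[OF assms _ _ elim(1)]) (simp_all add: \<tau>_def)
    with elim(2) show ?case by (simp add: iter_def)
  qed
qed

text \<open>Let \<open>m = lg (length p) + 2\<close>. If \<open>n \<ge> m + c\<close>, then
  \<open>f\<close> exceeds all total waiting times, so \<open>p\<close> yields a constant above all
  outputs at 0 of programs shorter than \<open>2 ^ m\<close>. Its complexity is at most
  \<open>length p + d\<close>, which therefore cannot be below \<open>2 ^ m\<close>. As
  \<open>2 ^ m > 2 * (length p + 1)\<close>, this is possible for short \<open>p\<close>
  only.\<close>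

lemma exceeding_program_length:
  assumes "optimal_language U"
  shows "\<exists>c d. \<forall>n p f. computes U p f \<longrightarrow>
     (\<forall>g. computable g \<and> complexity U g \<le> enat n \<longrightarrow> exceeds f g) \<longrightarrow>
     lg (length p) + 2 + c \<le> n \<longrightarrow> 2 ^ (lg (length p) + 2) \<le> length p + d"
proof -
  \<comment> \<open>The program of length \<open>m\<close> with payload \<open>b\<close> computes at
    \<open>x\<close> the first time \<open>t \<ge> x\<close> at which bit \<open>b\<close> of the
    counter is set.\<close>
  define P where "P t c x \<longleftrightarrow> x \<le> t \<and> odd (halted (lg c) t div 2 ^ payload c)" for t c x
  define G where "G t c x = t" for t c x :: nat
  have V: "computable_language (search_language P G)"
    unfolding P_def G_def
    by (intro computable_search_language tc_intros tc_halted tc_lg tc_payload) auto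
  obtain c where c: "\<And>p f. computes (search_language P G) p f \<Longrightarrow> complexity U f \<le> enat (length p + c)"
    using optimal_language_bound[OF assms V] by blast
  \<comment> \<open>The program \<open>p\<close> of \<open>f\<close> is reused as program of this
    language. Its length is \<open>lg c\<close>, so \<open>m\<close> costs no further bits. The
    search is the same for all \<open>x\<close>, which makes the resulting function
    constant.\<close>
  define P' where "P' T c x \<longleftrightarrow> iter T c (2 ^ (lg (lg c) + 2)) \<noteq> 0" for T c x :: nat
  define G' where "G' T c x =
      Suc (\<Sum>i<2 ^ 2 ^ (lg (lg c) + 2) - 1. a (iter T c (2 ^ (lg (lg c) + 2)) - 1) i 0)" for T c x :: nat
  have V': "computable_language (search_language P' G')"
    unfolding P'_def G'_def
    by (intro computable_search_language tc_intros tc_approx tc_iter tc_lg) auto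
  obtain d where d: "\<And>p f. computes (search_language P' G') p f \<Longrightarrow> complexity U f \<le> enat (length p + d)"
    using optimal_language_bound[OF assms V'] by blast
  show ?thesis
  proof (rule exI[of _ c], rule exI[of _ d], intro allI impI, rule ccontr)
    fix n p f
    assume p: "computes U p f"
      and ex: "\<forall>g. computable g \<and> complexity U g \<le> enat n \<longrightarrow> exceeds f g"
      and n: "lg (length p) + 2 + c \<le> n"
      and contra: "\<not> 2 ^ (lg (length p) + 2) \<le> length p + d"
    define m where "m = lg (length p) + 2"
    define \<tau> where "\<tau> = rec_nat 0 (\<lambda>_ t. t + f t)"
    have \<tau>: "\<tau> 0 = 0" "\<And>k. \<tau> (Suc k) = \<tau> k + f (\<tau> k)" by (simp_all add: \<tau>_def)
    have "mono \<tau>" using \<tau>(2) by (intro mono_iff_le_Suc[THEN iffD2]) simp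
    obtain M t0 where M: "\<And>t. t0 \<le> t \<Longrightarrow> halted m t = M" "\<And>t. halted m t \<le> M"
      using halted_final[of m] by blast
    have "\<exists>s. \<tau> k \<le> s \<and> s \<le> \<tau> (Suc k) \<and> odd (halted m s div 2 ^ b)"
      if b: "b < 2 ^ m" "odd (M div 2 ^ b)" for b k
    proof -
      obtain q where q: "length q = m" "payload (string_code q) = b"
        using b(1) by (rule ex_string_payload)
      have P_q: "P t (string_code q) x \<longleftrightarrow> x \<le> t \<and> odd (halted m t div 2 ^ b)" for t x
        by (simp add: P_def q)
      \<comment> \<open>From \<open>t0\<close> on the counter equals \<open>M\<close>, which has bit
        \<open>b\<close> set, so the waiting time is total.\<close>
      have exP: "\<exists>t. P t (string_code q) x" for x
        unfolding P_q using M(1)[of "max x t0"] b(2) by (intro exI[of _ "max x t0"]) simp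
      define g where "g x = (LEAST t. P t (string_code q) x)" for x
      have g: "computes (search_language P G) q g"
        using computes_search_language[of P q G, OF exP] by (simp add: g_def[abs_def] G_def)
      have "complexity U g \<le> enat (length q + c)" by (rule c[OF g])
      also have "\<dots> \<le> enat n" using n q by (simp add: m_def)
      finally have "exceeds f g" using ex computable_if_computes[OF V g] by blast
      then have "g (\<tau> k) < f (\<tau> k)" by (simp add: exceeds_def)
      moreover have "P (g (\<tau> k)) (string_code q) (\<tau> k)"
        unfolding g_def using exP by (rule LeastI_ex)
      \<comment> \<open>Waiting times are absolute: \<open>\<tau> k \<le> g (\<tau> k) < f (\<tau>
        k) \<le> \<tau> (Suc k)\<close>.\<close>
      ultimately show ?thesis unfolding P_q \<tau>(2) by (intro exI[of _ "g (\<tau> k)"]) simp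
    qed
    moreover have "M < 2 ^ 2 ^ m" using M(1)[of t0] halted_less[of m t0] by simp
    ultimately have halted: "halted m (\<tau> (2 ^ m)) = M"
      using mono_halted M(2) \<open>mono \<tau>\<close> by (intro counter_stabilises) auto
    define v where "v = Suc (\<Sum>i<2 ^ 2 ^ m - 1. a (\<tau> (2 ^ m)) i 0)"
    have exP': "\<exists>T. P' T (string_code p) x" for x
      unfolding P'_def using eventually_happens'[OF sequentially_bot eventually_iter[OF p]] by blast
    have "G' (LEAST T. P' T (string_code p) x) (string_code p) x = v" for x
    proof -
      let ?T = "LEAST T. P' T (string_code p) x"
      have "P' ?T (string_code p) x" using exP' by (rule LeastI_ex)
      then have "iter ?T (string_code p) (2 ^ m) \<noteq> 0"
        by (simp only: P'_def lg_string_code m_def not_False_eq_True)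
      from iter_correct[OF p \<tau> this] show ?thesis
        by (simp only: G'_def v_def lg_string_code m_def diff_Suc_1)
    qed
    with computes_search_language[of P' p G', OF exP']
    have "computes (search_language P' G') p (\<lambda>x. v)" by simp
    then have "complexity U (\<lambda>x. v) \<le> enat (length p + d)" by (rule d)
    then obtain q where q: "computes U q (\<lambda>x. v)" "length q \<le> length p + d"
      by (rule complexity_leE)
    define i where "i = string_code q"
    have "length q \<le> 2 ^ m - 1" using q(2) contra by (simp add: m_def)
    then have i: "i < 2 ^ 2 ^ m - 1"
      using string_code_less[of q "2 ^ m - 1"] by (simp add: i_def)
    obtain t where t: "a t i 0 \<noteq> 0"
      using tot_if_computes[OF q(1)] unfolding tot_def i_def by blast
    define t' where "t' = max (max t t0) (\<tau> (2 ^ m))"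
    let ?H = "\<lambda>t. {i. i < 2 ^ 2 ^ m - 1 \<and> a t i 0 \<noteq> 0}"
    \<comment> \<open>At time \<open>\<tau> (2 ^ m)\<close> the count is final, so no counted
      program halts on 0 later; in particular \<open>q\<close> has halted by then.\<close>
    have "?H (\<tau> (2 ^ m)) = ?H t'"
    proof (rule card_seteq)
      show "?H (\<tau> (2 ^ m)) \<subseteq> ?H t'" by (rule halted_subset) (simp add: t'_def)
      show "card (?H t') \<le> card (?H (\<tau> (2 ^ m)))"
        unfolding halted_card[symmetric] halted by (rule M(2))
    qed simp
    moreover have "i \<in> ?H t'"
      using i t approx_stable[of t t' i 0] by (simp add: t'_def)
    ultimately have "a (\<tau> (2 ^ m)) i 0 \<noteq> 0" by blast
    then have "a (\<tau> (2 ^ m)) i 0 = Suc v"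
      using q(1) unfolding i_def by (intro approx_eqI) (simp_all add: computes_def)
    \<comment> \<open>The output \<open>v\<close> of \<open>q\<close> contributes
      \<open>v + 1\<close> to a sum whose value is \<open>v - 1\<close>.\<close>
    moreover have "a (\<tau> (2 ^ m)) i 0 \<le> (\<Sum>i<2 ^ 2 ^ m - 1. a (\<tau> (2 ^ m)) i 0)"
      using i by (intro member_le_sum) auto
    ultimately show False by (simp add: v_def)
  qed
qed

end

section \<open>Lower bounds for the complexity of weakly exceeding and of exceeding
  functions\<close>

lemma complexity_gt_if_weakly_exceeds:
  assumes "computable f"
    and "\<And>g. computable g \<Longrightarrow> complexity U g \<le> enat n \<Longrightarrow> weakly_exceeds f g"
  shows "enat n < complexity U f"
proof (rule ccontr)
  assume "\<not> enat n < complexity U f"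
  then have "weakly_exceeds f f" using assms by simp
  then show False by (simp add: weakly_exceeds_def)
qed

lemma weakly_exceeds_if_exceeds: "exceeds f g \<Longrightarrow> weakly_exceeds f g"
  by (simp add: exceeds_def weakly_exceeds_def)

lemma exceeds_lower_bound:
  assumes "optimal_language U"
  shows "\<exists>c::nat. \<forall>n f l. computable f \<longrightarrow>
     (\<forall>g. computable g \<and> complexity U g \<le> enat n \<longrightarrow> exceeds f g) \<longrightarrow>
     complexity U f = enat l \<longrightarrow> 2 ^ n \<le> 2 ^ c * l"
proof -
  have "computable_language U"
    using assms by (simp add: optimal_language_def godel_numbering_def)
  then obtain a where "approximation U a" by (rule ex_approximation)
  then interpret approximation U a .
  obtain c d where cd: "\<forall>n p f. computes U p f \<longrightarrow>
     (\<forall>g. computable g \<and> complexity U g \<le> enat n \<longrightarrow> exceeds f g) \<longrightarrow>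
     lg (length p) + 2 + c \<le> n \<longrightarrow> 2 ^ (lg (length p) + 2) \<le> length p + d"
    using exceeding_program_length[OF assms] by blast
  show ?thesis
  proof (intro exI[of _ "c + d + 2"] allI impI)
    fix n f l
    assume f: "computable f"
      and ex: "\<forall>g. computable g \<and> complexity U g \<le> enat n \<longrightarrow> exceeds f g"
      and "complexity U f = enat l"
    then obtain p where p: "computes U p f" "length p = l"
      using complexity_leE[of U f l] by auto
    have "enat n < complexity U f"
      using f ex weakly_exceeds_if_exceeds by (intro complexity_gt_if_weakly_exceeds) auto
    then have nl: "n < l" using \<open>complexity U f = enat l\<close> by simp
    show "(2::nat) ^ n \<le> 2 ^ (c + d + 2) * l"
    proof (cases "lg l + 2 + c \<le> n")
      case True
      then have "2 ^ (lg l + 2) \<le> l + d" using cd p ex by blast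
      moreover have "2 * Suc l < 2 ^ (lg l + 2)" using lg_bounds(2)[of l] by simp
      \<comment> \<open>From \<open>2 * (l + 1) < l + d\<close> follows \<open>l < d\<close>, so
        only small \<open>n\<close> occur, and the constant absorbs them.\<close>
      ultimately have "n \<le> d" using nl by simp
      then have "(2::nat) ^ n \<le> 2 ^ (c + d + 2)" by (intro power_increasing) auto
      then show ?thesis using nl by (cases l) auto
    next
      case False
      \<comment> \<open>Now \<open>n \<le> lg l + c + 1\<close>, and
        \<open>2 ^ lg l \<le> l + 1 \<le> 2 * l\<close> since \<open>l > n\<close>.\<close>
      then have "(2::nat) ^ n \<le> 2 ^ (lg l + (c + 1))" by (intro power_increasing) auto
      also have "\<dots> = 2 ^ (c + 1) * 2 ^ lg l" by (simp add: power_add)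
      also have "\<dots> \<le> 2 ^ (c + 1) * (2 * l)"
        using lg_bounds(1)[of l] nl by (intro mult_left_mono) auto
      also have "\<dots> = 2 ^ (c + 2) * l" by simp
      also have "\<dots> \<le> 2 ^ (c + d + 2) * l"
        by (intro mult_right_mono power_increasing) auto
      finally show ?thesis .
    qed
  qed
qed

theorem theorem1:
  fixes U :: language
  assumes "optimal_language U"
  shows "(\<exists>c::nat. \<forall>n::nat. \<exists>m::nat. m_w U n = enat m \<and> \<bar>int m - int n\<bar> \<le> int c) \<and>
         (\<exists>c::nat. \<forall>n::nat. \<exists>m::nat. m_e U n = enat m \<and>
            2 powr (real n - real c) \<le> real m \<and> real m \<le> 2 powr (real n + real c))"
proof
  have "computable_language U"
    using assms by (simp add: optimal_language_def godel_numbering_def)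
  then obtain a where "approximation U a" by (rule ex_approximation)
  then interpret approximation U a .

  obtain c where c: "\<And>n. \<exists>f. computable f \<and> complexity U f \<le> enat (n + c) \<and>
     (\<forall>g. computable g \<and> complexity U g \<le> enat n \<longrightarrow> weakly_exceeds f g)"
    using weakly_exceeds_bound[OF assms] by blast
  show "\<exists>c::nat. \<forall>n::nat. \<exists>m::nat. m_w U n = enat m \<and> \<bar>int m - int n\<bar> \<le> int c"
  proof (rule exI[of _ c], rule allI)
    fix n
    from c[of n] obtain f where f: "computable f" "complexity U f \<le> enat (n + c)"
      "\<forall>g. computable g \<and> complexity U g \<le> enat n \<longrightarrow> weakly_exceeds f g" by blast
    have "m_w U n \<le> complexity U f"
      unfolding m_w_def using f by (intro Inf_lower) blast
    also note f(2)
    finally have upper: "m_w U n \<le> enat (n + c)" .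
    have lower: "enat n \<le> m_w U n"
      unfolding m_w_def
      by (rule Inf_greatest) (auto intro!: less_imp_le complexity_gt_if_weakly_exceeds)
    obtain m where m: "m_w U n = enat m" using upper by (cases "m_w U n") auto
    then show "\<exists>m::nat. m_w U n = enat m \<and> \<bar>int m - int n\<bar> \<le> int c"
      using upper lower by (intro exI[of _ m]) auto
  qed

  obtain c where c: "\<And>n. \<exists>f. computable f \<and> complexity U f \<le> enat (2 ^ Suc n + c) \<and>
     (\<forall>g. computable g \<and> complexity U g \<le> enat n \<longrightarrow> exceeds f g)"
    using exceeds_bound[OF assms] by blast
  obtain d :: nat where d: "\<forall>n f l. computable f \<longrightarrow>
     (\<forall>g. computable g \<and> complexity U g \<le> enat n \<longrightarrow> exceeds f g) \<longrightarrow>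
     complexity U f = enat l \<longrightarrow> 2 ^ n \<le> 2 ^ d * l"
    using exceeds_lower_bound[OF assms] by blast
  show "\<exists>c::nat. \<forall>n::nat. \<exists>m::nat. m_e U n = enat m \<and>
            2 powr (real n - real c) \<le> real m \<and> real m \<le> 2 powr (real n + real c)"
  \<comment> \<open>The part \<open>d\<close> serves the lower bound, \<open>c + 1\<close> the upper
    one.\<close>
  proof (rule exI[of _ "c + d + 1"], rule allI)
    fix n
    let ?A = "{complexity U f | f. computable f \<and>
     (\<forall>g. computable g \<and> complexity U g \<le> enat n \<longrightarrow> exceeds f g)}"
    from c[of n] obtain f where f: "computable f" "complexity U f \<le> enat (2 ^ Suc n + c)"
      "\<forall>g. computable g \<and> complexity U g \<le> enat n \<longrightarrow> exceeds f g" by blast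
    then have fA: "complexity U f \<in> ?A" by blast
    then have "m_e U n \<le> complexity U f"
      unfolding m_e_def by (rule Inf_lower)
    also note f(2)
    finally have upper: "m_e U n \<le> enat (2 ^ Suc n + c)" .
    then obtain m where m: "m_e U n = enat m" by (cases "m_e U n") auto
    \<comment> \<open>A non-empty set attains its infimum, so the lower bound can be applied to a
      minimising \<open>h\<close>.\<close>
    have "m_e U n \<in> ?A"
      unfolding m_e_def Inf_enat_def using fA by (auto intro: LeastI)
    then obtain h where "computable h" "complexity U h = enat m"
      "\<forall>g. computable g \<and> complexity U g \<le> enat n \<longrightarrow> exceeds h g"
      unfolding m by force
    then have lower: "2 ^ n \<le> 2 ^ d * m" using d by blast
    have "2 powr (real n - real (c + d + 1)) \<le> 2 powr (real n - real d)"
      by (intro powr_mono) auto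
    also have "real (2 ^ n) \<le> real (2 ^ d * m)" using lower by (rule of_nat_mono)
    then have "2 powr (real n - real d) \<le> real m"
      by (simp add: powr_diff powr_realpow field_simps)
    finally have lo: "2 powr (real n - real (c + d + 1)) \<le> real m" .
    have "m \<le> 2 ^ Suc n + c" using upper m by simp
    also have "\<dots> \<le> 2 ^ Suc n * Suc c" by simp
    also have "\<dots> \<le> 2 ^ Suc n * 2 ^ (c + d)"
      using less_exp[of c] power_increasing[of c "c + d" "2::nat"]
      by (intro mult_left_mono) linarith+
    also have "\<dots> = 2 ^ (n + (c + d + 1))" by (simp add: power_add)
    finally have "real m \<le> real (2 ^ (n + (c + d + 1)))" by (rule of_nat_mono)
    also have "\<dots> = 2 powr real (n + (c + d + 1))"
      by (simp only: powr_realpow zero_less_numeral of_nat_power of_nat_numeral)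
    finally have hi: "real m \<le> 2 powr (real n + real (c + d + 1))" by (simp only: of_nat_add)
    show "\<exists>m::nat. m_e U n = enat m \<and>
            2 powr (real n - real (c + d + 1)) \<le> real m \<and> real m \<le> 2 powr (real n + real (c + d + 1))"
      using m lo hi by blast
  qed
qed

end
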